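(* Let $\mathbf{W}:[0,1]^2\to[0,1]$ be a graphon with normalized Laplacian $\overline{\mathcal{L}}$ on $L^2([0,1])$. Let $S$ be a measurable proper subset of $[0,1]$ and $\Lambda>0$ such that the Poincaré inequality $$\|X\|_{L^2}\le\Lambda\,\|\overline{\mathcal{L}}X\|_{L^2}$$ holds for all $X\in L^2([0,1])$ supported only on $S$. Then $U=[0,1]\setminus S$ is a uniqueness set for $PW_\lambda(\mathbf{W})$ for every $\lambda\ge0$ with $\lambda<1/\Lambda$.
   Context: A graphon is a symmetric, bounded, measurable function $\mathbf{W}:[0,1]^2\to[0,1]$. Its degree function is $\mathbf{d}(v)=\int_0^1\mathbf{W}(u,v)\,du$. The normalized graphon is $\overline{\mathbf{W}}(u,v)=\mathbf{W}(u,v)/\sqrt{\mathbf{d}(u)\mathbf{d}(v)}$ if $\mathbf{d}(u),\mathbf{d}(v)\ne0$ and $0$ otherwise. The normalized Laplacian on $L^2([0,1])$ is $\overline{\mathcal{L}}X=X-\int_0^1\overline{\mathbf{W}}(u,\cdot)X(u)\,du$. It is taken as a standing fact that $\overline{\mathcal{L}}$ has countably many nonnegative eigenvalues $\lambda_i\in[0,2]$ with corresponding eigenfunctions $\varphi_i$ forming an orthonormal basis of $L^2([0,1])$. For $X\in L^2([0,1])$ put $\hat X(\lambda_i)=\int_0^1X(u)\varphi_i(u)\,du$. The Paley–Wiener space with cutoff $\lambda$ is $PW_\lambda(\mathbf{W})=\{X\in L^2([0,1]):\hat X(\lambda_i)=0\text{ for all }i\text{ with }\lambda_i>\lambda\}$.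 A measurable $U\subseteq[0,1]$ is a uniqueness set for a signal space $\mathcal{H}\subseteq L^2([0,1])$ if for all $X,Y\in\mathcal{H}$, $\int_U|X(u)-Y(u)|^2\,du=0$ implies $\|X-Y\|_{L^2([0,1])}^2=0$. *)

theory Defs
  imports "HOL-Analysis.Analysis"
begin

abbreviation I01 :: "real measure" where
  "I01 \<equiv> lebesgue_on {0..1}"

text \<open>Measurability is Lebesgue measurability throughout. Elements of the real Hilbert space
  \<open>L\<^sup>2([0,1])\<close> are represented by functions on the reals, identified when they agree almost
  everywhere on the unit interval; values outside of it are irrelevant.\<close>

definition L2 :: "(real \<Rightarrow> real) set" where
  "L2 = {X \<in> borel_measurable I01. integrable I01 (\<lambda>u. (X u)\<^sup>2)}"

definition L2_inner :: "(real \<Rightarrow> real) \<Rightarrow> (real \<Rightarrow> real) \<Rightarrow> real" where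
  "L2_inner X Y = (\<integral>u. X u * Y u \<partial>I01)"

definition L2_norm :: "(real \<Rightarrow> real) \<Rightarrow> real" where
  "L2_norm X = sqrt (\<integral>u. (X u)\<^sup>2 \<partial>I01)"

definition graphon :: "(real \<Rightarrow> real \<Rightarrow> real) \<Rightarrow> bool" where
  "graphon W \<longleftrightarrow>
     (\<lambda>(u, v). W u v) \<in> borel_measurable (lebesgue_on ({0..1} \<times> {0..1})) \<and>
     (\<forall>u\<in>{0..1}. \<forall>v\<in>{0..1}. W u v = W v u \<and> 0 \<le> W u v \<and> W u v \<le> 1)"

text \<open>A section of \<open>W\<close> may fail to be measurable for a null set of \<open>v\<close>; there the integral, and
  with it the degree, is 0 by convention.\<close>

definition graphon_degree :: "(real \<Rightarrow> real \<Rightarrow> real) \<Rightarrow> real \<Rightarrow> real" where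
  "graphon_degree W v = (\<integral>u. W u v \<partial>I01)"

definition normalized_graphon :: "(real \<Rightarrow> real \<Rightarrow> real) \<Rightarrow> real \<Rightarrow> real \<Rightarrow> real" where
  "normalized_graphon W u v =
     (if graphon_degree W u \<noteq> 0 \<and> graphon_degree W v \<noteq> 0
      then W u v / sqrt (graphon_degree W u * graphon_degree W v) else 0)"

definition normalized_laplacian ::
    "(real \<Rightarrow> real \<Rightarrow> real) \<Rightarrow> (real \<Rightarrow> real) \<Rightarrow> real \<Rightarrow> real" where
  "normalized_laplacian W X v = X v - (\<integral>u. normalized_graphon W u v * X u \<partial>I01)"

definition orthonormal_basis_L2 :: "(nat \<Rightarrow> real \<Rightarrow> real) \<Rightarrow> bool" where
  "orthonormal_basis_L2 \<phi> \<longleftrightarrow>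
     (\<forall>i. \<phi> i \<in> L2) \<and>
     (\<forall>i j. L2_inner (\<phi> i) (\<phi> j) = (if i = j then 1 else 0)) \<and>
     (\<forall>X\<in>L2. (\<lambda>n. L2_norm (\<lambda>u. X u - (\<Sum>i<n. L2_inner X (\<phi> i) * \<phi> i u))) \<longlonglongrightarrow> 0)"

text \<open>The eigenvalues are listed with multiplicity. Indexing by the natural numbers is no
  restriction, since \<open>L\<^sup>2([0,1])\<close> is separable and infinite-dimensional. The normalized
  kernel of a general graphon need not give a compact operator, so the existence of such a
  system is a hypothesis rather than derived.\<close>

definition laplacian_eigensystem ::
    "(real \<Rightarrow> real \<Rightarrow> real) \<Rightarrow> (nat \<Rightarrow> real) \<Rightarrow> (nat \<Rightarrow> real \<Rightarrow> real) \<Rightarrow> bool" where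
  "laplacian_eigensystem W ev \<phi> \<longleftrightarrow>
     orthonormal_basis_L2 \<phi> \<and>
     (\<forall>i. 0 \<le> ev i \<and> ev i \<le> 2) \<and>
     (\<forall>i. AE v in I01. normalized_laplacian W (\<phi> i) v = ev i * \<phi> i v)"

definition fourier_coeff :: "(nat \<Rightarrow> real \<Rightarrow> real) \<Rightarrow> (real \<Rightarrow> real) \<Rightarrow> nat \<Rightarrow> real" where
  "fourier_coeff \<phi> X i = L2_inner X (\<phi> i)"

text \<open>The graphon enters only through its eigensystem \<open>(ev, \<phi>)\<close>.\<close>

definition paley_wiener ::
    "(nat \<Rightarrow> real) \<Rightarrow> (nat \<Rightarrow> real \<Rightarrow> real) \<Rightarrow> real \<Rightarrow> (real \<Rightarrow> real) set" where
  "paley_wiener ev \<phi> \<omega> = {X \<in> L2. \<forall>i. ev i > \<omega> \<longrightarrow> fourier_coeff \<phi> X i = 0}"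

definition uniqueness_set :: "real set \<Rightarrow> (real \<Rightarrow> real) set \<Rightarrow> bool" where
  "uniqueness_set U H \<longleftrightarrow>
     U \<in> sets lebesgue \<and> U \<subseteq> {0..1} \<and>
     (\<forall>X\<in>H. \<forall>Y\<in>H. (\<integral>u. \<bar>X u - Y u\<bar>\<^sup>2 \<partial>lebesgue_on U) = 0 \<longrightarrow>
        (L2_norm (\<lambda>u. X u - Y u))\<^sup>2 = 0)"

definition supported_on :: "(real \<Rightarrow> real) \<Rightarrow> real set \<Rightarrow> bool" where
  "supported_on X S \<longleftrightarrow> (AE u in I01. u \<notin> S \<longrightarrow> X u = 0)"

end

theory Submission
  imports Defs
begin

text \<open>The difference \<open>Z\<close> of two signals in the Paley--Wiener space that agree on the complement of
  \<open>S\<close> is supported on \<open>S\<close>, so \<open>\<parallel>Z\<parallel> \<le> \<Lambda> \<parallel>L Z\<parallel>\<close>. On the other hand \<open>L\<close> is symmetric, so the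
  coefficients of \<open>L Z\<close> are \<open>ev i\<close> times those of \<open>Z\<close>, and Parseval gives \<open>\<parallel>L Z\<parallel> \<le> \<omega> \<parallel>Z\<parallel>\<close>.
  As \<open>\<Lambda> \<omega> < 1\<close>, this forces \<open>\<parallel>Z\<parallel> = 0\<close>. Symmetry of \<open>L\<close> is Fubini's theorem, which applies
  because the normalized kernel, though unbounded, is dominated through
  \<open>\<bar>a b\<bar> / sqrt (d d') \<le> a\<^sup>2 / d + b\<^sup>2 / d'\<close>, and integrating \<open>w / d\<close> over one variable gives at
  most 1.\<close>

section \<open>Lebesgue measure on the unit interval\<close>

lemma finite_measure_I01: "finite_measure I01"
  by (rule finite_measure_lebesgue_on) simp

interpretation I01: finite_measure I01
  by (rule finite_measure_I01)

interpretation I01_pair: pair_sigma_finite I01 I01 ..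

lemma complete_measure_I01: "complete_measure I01"
proof
  fix A B assume "B \<subseteq> A" "A \<in> null_sets I01"
  then show "B \<in> sets I01"
    by (auto simp: null_sets_restrict_space sets_restrict_space_iff intro: completion.complete)
qed

text \<open>Preimages under \<open>f\<close> and \<open>g\<close> differ only inside a null set, and
  completeness makes every subset of a null set measurable. Measurability of \<open>g\<close> is a
  conclusion here; this is how integrals involving the merely Lebesgue measurable \<open>W\<close>
  are handled later.\<close>

lemma (in complete_measure) measurable_cong_AE:
  assumes "f \<in> M \<rightarrow>\<^sub>M N" "AE x in M. g x = f x" "g \<in> space M \<rightarrow> space N"
  shows "g \<in> M \<rightarrow>\<^sub>M N"
proof (rule measurableI)
  fix A assume A: "A \<in> sets N"
  show "g -` A \<inter> space M \<in> sets M"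
  proof (rule in_sets_AE)
    show "AE x in M. (x \<in> f -` A \<inter> space M) = (x \<in> g -` A \<inter> space M)"
      using assms(2) by eventually_elim auto
  qed (use assms(1) A in auto)
qed (use assms(3) in auto)

lemma borel_measurable_I01_cong_AE:
  fixes f :: "real \<Rightarrow> real"
  assumes "f \<in> borel_measurable I01" "AE x in I01. g x = f x"
  shows "g \<in> borel_measurable I01"
  using complete_measure.measurable_cong_AE[OF complete_measure_I01 assms] by simp

lemma integral_I01_cong_AE:
  fixes f :: "real \<Rightarrow> real"
  assumes "f \<in> borel_measurable I01" "AE x in I01. g x = f x"
  shows "(\<integral>x. g x \<partial>I01) = (\<integral>x. f x \<partial>I01)"
  using borel_measurable_I01_cong_AE[OF assms] assms by (intro integral_cong_AE) auto

section \<open>Square-integrable functions and Parseval's identity\<close>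

lemma mult_le_sum_power2:
  fixes a b :: real
  assumes "0 \<le> a" "0 \<le> b"
  shows "a * b \<le> a\<^sup>2 + b\<^sup>2"
  using sum_squares_bound[of a b] mult_nonneg_nonneg[OF assms] by linarith

lemma L2_mult_integrable:
  assumes "X \<in> L2" "Y \<in> L2"
  shows "integrable I01 (\<lambda>u. X u * Y u)"
proof (rule Bochner_Integration.integrable_bound)
  show "integrable I01 (\<lambda>u. (X u)\<^sup>2 + (Y u)\<^sup>2)"
    using assms by (auto simp: L2_def)
  show "(\<lambda>u. X u * Y u) \<in> borel_measurable I01"
    using assms by (auto simp: L2_def)
  show "AE u in I01. norm (X u * Y u) \<le> norm ((X u)\<^sup>2 + (Y u)\<^sup>2)"
    using mult_le_sum_power2[of "\<bar>X u\<bar>" "\<bar>Y u\<bar>" for u] by (simp add: abs_mult)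
qed

lemma L2_add:
  assumes "X \<in> L2" "Y \<in> L2"
  shows "(\<lambda>u. X u + Y u) \<in> L2"
  using assms L2_mult_integrable[OF assms]
  by (auto simp: L2_def power2_sum mult.assoc)

lemma L2_scale: "X \<in> L2 \<Longrightarrow> (\<lambda>u. c * X u) \<in> L2"
  by (auto simp: L2_def power_mult_distrib)

lemma L2_diff:
  assumes "X \<in> L2" "Y \<in> L2"
  shows "(\<lambda>u. X u - Y u) \<in> L2"
  using L2_add[OF assms(1) L2_scale[OF assms(2), of "-1"]] by simp

lemma L2_sum:
  assumes "\<And>i. i \<in> A \<Longrightarrow> X i \<in> L2"
  shows "(\<lambda>u. \<Sum>i\<in>A. X i u) \<in> L2"
  using assms
proof (induction A rule: infinite_finite_induct)
  case (insert a A)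
  then show ?case by (simp add: L2_add)
qed (simp_all add: L2_def)

lemma L2_norm_power2: "(L2_norm X)\<^sup>2 = (\<integral>u. (X u)\<^sup>2 \<partial>I01)"
  by (simp add: L2_norm_def)

text \<open>Pythagoras, by induction on \<open>n\<close>. The remainder \<open>R\<close> has the
  same coefficient \<open>c n\<close> along \<open>\<phi> n\<close> as \<open>X\<close>, because the
  terms already subtracted are orthogonal to \<open>\<phi> n\<close>; removing that component lowers
  the squared norm by \<open>(c n)\<^sup>2\<close>.\<close>

lemma L2_norm_remainder:
  fixes \<phi> :: "nat \<Rightarrow> real \<Rightarrow> real"
  assumes \<phi>: "\<And>i. \<phi> i \<in> L2"
    and orth: "\<And>i j. L2_inner (\<phi> i) (\<phi> j) = (if i = j then 1 else 0)"
    and X: "X \<in> L2"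
  shows "(L2_norm (\<lambda>u. X u - (\<Sum>i<n. L2_inner X (\<phi> i) * \<phi> i u)))\<^sup>2
         = (L2_norm X)\<^sup>2 - (\<Sum>i<n. (L2_inner X (\<phi> i))\<^sup>2)"
proof (induction n)
  case (Suc n)
  define c where "c i = L2_inner X (\<phi> i)" for i
  define R where "R = (\<lambda>u. X u - (\<Sum>i<n. c i * \<phi> i u))"
  have R: "R \<in> L2"
    unfolding R_def by (intro L2_diff L2_sum L2_scale X \<phi>)
  have "L2_inner R (\<phi> n) = (\<integral>u. X u * \<phi> n u - (\<Sum>i<n. c i * (\<phi> i u * \<phi> n u)) \<partial>I01)"
    unfolding L2_inner_def R_def by (simp add: left_diff_distrib sum_distrib_right mult.assoc)
  also have "\<dots> = c n - (\<Sum>i<n. c i * L2_inner (\<phi> i) (\<phi> n))"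
    unfolding c_def L2_inner_def
    by (simp add: L2_mult_integrable X \<phi>)
  also have "\<dots> = c n"
    by (simp add: orth)
  finally have Rn: "(\<integral>u. R u * \<phi> n u \<partial>I01) = c n"
    by (simp add: L2_inner_def)
  have nn: "(\<integral>u. \<phi> n u * \<phi> n u \<partial>I01) = 1"
    using orth[of n n] by (simp add: L2_inner_def)
  have "(L2_norm (\<lambda>u. X u - (\<Sum>i<Suc n. c i * \<phi> i u)))\<^sup>2
      = (\<integral>u. (R u)\<^sup>2 - 2 * c n * (R u * \<phi> n u) + (c n)\<^sup>2 * (\<phi> n u * \<phi> n u) \<partial>I01)"
    unfolding L2_norm_power2 R_def
    by (intro Bochner_Integration.integral_cong) (auto simp: power2_eq_square algebra_simps)
  also have "\<dots> = (L2_norm R)\<^sup>2 - 2 * c n * c n + (c n)\<^sup>2"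
  proof -
    have "integrable I01 (\<lambda>u. (R u)\<^sup>2)" "integrable I01 (\<lambda>u. R u * \<phi> n u)"
        "integrable I01 (\<lambda>u. \<phi> n u * \<phi> n u)"
      using R \<phi> by (auto simp: L2_mult_integrable) (simp add: L2_def)
    then show ?thesis
      by (simp add: Rn nn L2_norm_power2)
  qed
  also have "\<dots> = (L2_norm X)\<^sup>2 - (\<Sum>i<Suc n. (c i)\<^sup>2)"
    using Suc.IH by (simp add: R_def c_def power2_eq_square)
  finally show ?case
    by (simp add: c_def)
qed simp

text \<open>Completeness of the basis sends the remainders to 0, so by the remainder formula the
  partial sums of the squared coefficients tend to the squared norm.\<close>

lemma parseval:
  assumes "orthonormal_basis_L2 \<phi>" "X \<in> L2"
  shows "(\<lambda>i. (L2_inner X (\<phi> i))\<^sup>2) sums (L2_norm X)\<^sup>2"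
proof -
  have "(\<lambda>n. (L2_norm (\<lambda>u. X u - (\<Sum>i<n. L2_inner X (\<phi> i) * \<phi> i u)))\<^sup>2) \<longlonglongrightarrow> 0\<^sup>2"
    using assms unfolding orthonormal_basis_L2_def by (intro tendsto_power) auto
  moreover have "(L2_norm (\<lambda>u. X u - (\<Sum>i<n. L2_inner X (\<phi> i) * \<phi> i u)))\<^sup>2
         = (L2_norm X)\<^sup>2 - (\<Sum>i<n. (L2_inner X (\<phi> i))\<^sup>2)" for n
    using assms unfolding orthonormal_basis_L2_def by (intro L2_norm_remainder) auto
  ultimately have "(\<lambda>n. (L2_norm X)\<^sup>2 - (\<Sum>i<n. (L2_inner X (\<phi> i))\<^sup>2)) \<longlonglongrightarrow> 0"
    by simp
  then have "(\<lambda>n. (L2_norm X)\<^sup>2 - ((L2_norm X)\<^sup>2 - (\<Sum>i<n. (L2_inner X (\<phi> i))\<^sup>2)))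
      \<longlonglongrightarrow> (L2_norm X)\<^sup>2 - 0"
    by (intro tendsto_diff tendsto_const)
  then show ?thesis
    by (simp add: sums_def)
qed

section \<open>The normalized kernel and its integrability\<close>

lemma normalized_graphon_sym:
  assumes "w u v = w v u"
  shows "normalized_graphon w u v = normalized_graphon w v u"
  using assms by (auto simp: normalized_graphon_def mult.commute)

lemma measurable_graphon_degree:
  assumes [measurable]: "(\<lambda>(u, v). w u v) \<in> borel_measurable (I01 \<Otimes>\<^sub>M I01)"
  shows "graphon_degree w \<in> borel_measurable I01"
proof -
  have "(\<lambda>v. \<integral>u. w u v \<partial>I01) \<in> borel_measurable I01"
    by measurable
  then show ?thesis
    by (simp add: graphon_degree_def[abs_def])
qed

lemma measurable_normalized_graphon:
  assumes [measurable]: "(\<lambda>(u, v). w u v) \<in> borel_measurable (I01 \<Otimes>\<^sub>M I01)"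
  shows "(\<lambda>(u, v). normalized_graphon w u v) \<in> borel_measurable (I01 \<Otimes>\<^sub>M I01)"
proof -
  have [measurable]: "graphon_degree w \<in> borel_measurable I01"
    by (rule measurable_graphon_degree) measurable
  show ?thesis
    unfolding normalized_graphon_def by measurable
qed

text \<open>Supplies the joint integrability that Fubini's theorem demands. Symmetry and bounds of
  \<open>w\<close> are assumed at all points; the Borel version of a graphon constructed below
  provides them.\<close>

lemma integrable_normalized_kernel:
  assumes w[measurable]: "(\<lambda>(u, v). w u v) \<in> borel_measurable (I01 \<Otimes>\<^sub>M I01)"
    and sym: "\<And>u v. w u v = w v u" and nonneg: "\<And>u v. 0 \<le> w u v" and le1: "\<And>u v. w u v \<le> 1"
    and f: "f \<in> L2" and g: "g \<in> L2"
  shows "integrable (I01 \<Otimes>\<^sub>M I01) (\<lambda>(u, v). normalized_graphon w u v * (f u * g v))"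
proof -
  let ?d = "graphon_degree w"
  have [measurable]: "?d \<in> borel_measurable I01"
    by (rule measurable_graphon_degree[OF w])
  have d0: "0 \<le> ?d u" for u
    unfolding graphon_degree_def by (intro integral_nonneg_AE) (simp add: nonneg)
  \<comment> \<open>One of the two dominating terms. Integrating first over the variable absent from
    \<open>h\<close> turns \<open>w\<close> into the degree at \<open>u\<close>, by symmetry, and
    this meets the denominator.\<close>
  have half: "integrable (I01 \<Otimes>\<^sub>M I01) (\<lambda>(u, v). w u v / ?d u * (h u)\<^sup>2)" if h: "h \<in> L2" for h
  proof (rule I01_pair.Fubini_integrable)
    have [measurable]: "h \<in> borel_measurable I01" using h by (simp add: L2_def)
    show "(\<lambda>(u, v). w u v / ?d u * (h u)\<^sup>2) \<in> borel_measurable (I01 \<Otimes>\<^sub>M I01)"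
      by measurable
    have eq: "(\<integral>v. norm (case (u, v) of (u, v) \<Rightarrow> w u v / ?d u * (h u)\<^sup>2) \<partial>I01)
        = ?d u / ?d u * (h u)\<^sup>2" for u
      using d0[of u] nonneg
      by (simp add: abs_mult abs_of_nonneg graphon_degree_def sym[of _ u])
    show "integrable I01 (\<lambda>u. \<integral>v. norm (case (u, v) of (u, v) \<Rightarrow> w u v / ?d u * (h u)\<^sup>2) \<partial>I01)"
      unfolding eq
    proof (rule Bochner_Integration.integrable_bound)
      show "integrable I01 (\<lambda>u. (h u)\<^sup>2)" using h by (simp add: L2_def)
    next
      show "(\<lambda>u. ?d u / ?d u * (h u)\<^sup>2) \<in> borel_measurable I01"
        by measurable
      \<comment> \<open>Division by zero gives 0, so the quotient is 0 where the degree vanishes and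
        1 elsewhere.\<close>
      show "AE u in I01. norm (?d u / ?d u * (h u)\<^sup>2) \<le> norm ((h u)\<^sup>2)"
        by (intro AE_I2) (simp add: divide_simps)
    qed
    show "AE u in I01. integrable I01 (\<lambda>v. case (u, v) of (u, v) \<Rightarrow> w u v / ?d u * (h u)\<^sup>2)"
    proof (rule AE_I2)
      fix u assume u: "u \<in> space I01"
      have "integrable I01 (\<lambda>v. w u v)"
      proof (rule I01.integrable_const_bound[where B = 1])
        show "(\<lambda>v. w u v) \<in> borel_measurable I01"
          using measurable_Pair2[OF w u] by simp
      qed (simp add: nonneg le1)
      then show "integrable I01 (\<lambda>v. case (u, v) of (u, v) \<Rightarrow> w u v / ?d u * (h u)\<^sup>2)"
        by simp
    qed
  qed
  have [measurable]: "f \<in> borel_measurable I01" "g \<in> borel_measurable I01"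
    using f g by (simp_all add: L2_def)
  show ?thesis
  proof (rule Bochner_Integration.integrable_bound)
    \<comment> \<open>The second summand is \<open>half\<close> for \<open>g\<close> with the
      coordinates swapped.\<close>
    show "integrable (I01 \<Otimes>\<^sub>M I01)
        (\<lambda>x. (case x of (u, v) \<Rightarrow> w u v / ?d u * (f u)\<^sup>2) + (case x of (u, v) \<Rightarrow> w v u / ?d v * (g v)\<^sup>2))"
      using half[OF f] I01_pair.integrable_product_swap[OF half[OF g]] by (simp add: case_prod_unfold)
    show "(\<lambda>(u, v). normalized_graphon w u v * (f u * g v)) \<in> borel_measurable (I01 \<Otimes>\<^sub>M I01)"
      using measurable_normalized_graphon[OF w] by measurable
    have "\<bar>normalized_graphon w u v * (f u * g v)\<bar>
        \<le> w u v / ?d u * (f u)\<^sup>2 + w v u / ?d v * (g v)\<^sup>2" for u v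
    proof (cases "?d u \<noteq> 0 \<and> ?d v \<noteq> 0")
      case True
      then have pos: "?d u > 0" "?d v > 0"
        using d0[of u] d0[of v] by auto
      \<comment> \<open>The square root of the product of degrees is split between the two factors,
        so that \<open>a\<^sup>2\<close> and \<open>b\<^sup>2\<close> each carry a single degree as
        denominator.\<close>
      define a b where "a = \<bar>f u\<bar> / sqrt (?d u)" and "b = \<bar>g v\<bar> / sqrt (?d v)"
      have "0 \<le> a" "0 \<le> b"
        using pos by (simp_all add: a_def b_def)
      then have "a * b \<le> a\<^sup>2 + b\<^sup>2"
        by (rule mult_le_sum_power2)
      then have "w u v * (a * b) \<le> w u v * (a\<^sup>2 + b\<^sup>2)"
        by (rule mult_left_mono) (rule nonneg)
      moreover have "\<bar>normalized_graphon w u v * (f u * g v)\<bar> = w u v * (a * b)"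
        using True pos nonneg[of u v]
        by (simp add: normalized_graphon_def a_def b_def abs_mult real_sqrt_mult)
      moreover have "w u v * (a\<^sup>2 + b\<^sup>2) = w u v / ?d u * (f u)\<^sup>2 + w v u / ?d v * (g v)\<^sup>2"
        using pos sym[of u v] by (simp add: a_def b_def power_divide algebra_simps)
      ultimately show ?thesis by simp
    next
      case False
      then show ?thesis
        using d0 nonneg by (auto simp: normalized_graphon_def intro!: add_nonneg_nonneg)
    qed
    then show "AE x in I01 \<Otimes>\<^sub>M I01. norm (case x of (u, v) \<Rightarrow> normalized_graphon w u v * (f u * g v))
      \<le> norm ((case x of (u, v) \<Rightarrow> w u v / ?d u * (f u)\<^sup>2) + (case x of (u, v) \<Rightarrow> w v u / ?d v * (g v)\<^sup>2))"
      by (intro AE_I2) (auto intro: order_trans[OF _ abs_ge_self])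
  qed
qed

section \<open>Replacing a graphon by a Borel version\<close>

lemma AE_lborel_imp_I01:
  assumes "AE x in lborel. P x"
  shows "AE x in I01. P x"
  using AE_completion[OF assms] by (subst AE_restrict_space_iff) auto

text \<open>\<open>W\<close> is only measurable for the completed product, so Fubini's theorem for
  \<open>I01 \<Otimes>\<^sub>M I01\<close> does not apply to it directly.\<close>

lemma graphon_borel_version:
  assumes "graphon W"
  obtains w where "(\<lambda>(u, v). w u v) \<in> borel_measurable (I01 \<Otimes>\<^sub>M I01)"
    "\<And>u v. w u v = w v u" "\<And>u v. 0 \<le> w u v" "\<And>u v. w u v \<le> 1"
    "AE v in I01. AE u in I01. W u v = w u v"
proof -
  let ?Q = "{0..1} \<times> {0..1} :: (real \<times> real) set"
  have Q: "?Q \<in> sets lebesgue"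
    by (intro sets_completionI_sets) (simp add: borel_closed closed_Times)
  have W: "W u v = W v u" "0 \<le> W u v" "W u v \<le> 1" if "u \<in> {0..1}" "v \<in> {0..1}" for u v
    using assms that unfolding graphon_def by blast+
  have "(\<lambda>(u, v). W u v) \<in> borel_measurable (lebesgue_on ?Q)"
    using assms unfolding graphon_def by blast
  \<comment> \<open>Extended by 0 to the plane, \<open>W\<close> is Lebesgue measurable and hence
    agrees almost everywhere with a Borel function \<open>g\<close>.\<close>
  from borel_measurable_if_I[OF this Q]
  obtain g where g: "g \<in> borel_measurable lborel"
    and ae: "AE x in lborel. (if x \<in> ?Q then case x of (u, v) \<Rightarrow> W u v else 0) = g x"
    using completion_ex_borel_measurable_real by blast
  \<comment> \<open>Clamping to the unit interval and averaging with the transpose make bounds and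
    symmetry hold everywhere. Where \<open>g\<close> matches \<open>W\<close> at both
    \<open>(u, v)\<close> and \<open>(v, u)\<close> in the unit square, neither operation changes
    the value.\<close>
  define w where "w u v = (max 0 (min 1 (g (u, v))) + max 0 (min 1 (g (v, u)))) / 2" for u v
  have [measurable]: "g \<in> borel_measurable (borel \<Otimes>\<^sub>M borel)"
    using g by (simp add: borel_prod)
  have [measurable]: "(\<lambda>x. x) \<in> I01 \<rightarrow>\<^sub>M borel"
    by (intro measurable_restrict_space1 measurable_completion) auto
  have ae': "AE x in lborel. fst x \<in> {0..1} \<longrightarrow> snd x \<in> {0..1} \<longrightarrow> W (fst x) (snd x) = g x"
    using ae by eventually_elim (auto simp: case_prod_unfold mem_Times_iff)
  \<comment> \<open>Reflection in the diagonal preserves planar Lebesgue measure, so the exceptional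
    set of \<open>ae'\<close> stays null after swapping coordinates.\<close>
  have ae'': "AE x in lborel. fst x \<in> {0..1} \<longrightarrow> snd x \<in> {0..1} \<longrightarrow> W (snd x) (fst x) = g (snd x, fst x)"
  proof -
    have "AE x in distr (lborel \<Otimes>\<^sub>M lborel) (lborel \<Otimes>\<^sub>M lborel) (\<lambda>(x, y). (y, x)).
        fst x \<in> {0..1} \<longrightarrow> snd x \<in> {0..1} \<longrightarrow> W (fst x) (snd x) = g x"
      using ae' unfolding lborel_pair.distr_pair_swap[symmetric] unfolding lborel_prod .
    from AE_distrD[OF measurable_pair_swap' this] show ?thesis
      unfolding lborel_prod by eventually_elim (simp add: case_prod_unfold)
  qed
  \<comment> \<open>Almost every slice of a planar null set is null.\<close>
  have "AE v in I01. AE u in I01. P v u"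
    if "AE x in lborel. fst x \<in> {0..1} \<longrightarrow> snd x \<in> {0..1} \<longrightarrow> P (fst x) (snd x)"
    for P :: "real \<Rightarrow> real \<Rightarrow> bool"
  proof -
    have "AE v in lborel. AE u in lborel. v \<in> {0..1} \<longrightarrow> u \<in> {0..1} \<longrightarrow> P v u"
      using lborel_pair.AE_pair[OF that[folded lborel_prod]] by simp
    then have "AE v in I01. AE u in I01. v \<in> {0..1} \<longrightarrow> u \<in> {0..1} \<longrightarrow> P v u"
      by (intro AE_lborel_imp_I01) (auto elim!: eventually_mono intro: AE_lborel_imp_I01)
    then show ?thesis
      using AE_space
    proof eventually_elim
      case (elim v)
      from elim(1) AE_space show ?case
        by eventually_elim (use elim(2) in auto)
    qed
  qed
  from this[of "\<lambda>u v. W u v = g (u, v)"] this[of "\<lambda>u v. W v u = g (v, u)"] ae' ae''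
  have *: "AE v in I01. AE u in I01. W v u = g (v, u)" "AE v in I01. AE u in I01. W u v = g (u, v)"
    by simp_all
  show ?thesis
  proof
    show "(\<lambda>(u, v). w u v) \<in> borel_measurable (I01 \<Otimes>\<^sub>M I01)"
      unfolding w_def by measurable
    show "w u v = w v u" "0 \<le> w u v" "w u v \<le> 1" for u v
      by (auto simp: w_def)
    from * AE_space show "AE v in I01. AE u in I01. W u v = w u v"
    proof eventually_elim
      case (elim v)
      from elim(1,2) AE_space show ?case
      proof eventually_elim
        case (elim u)
        with \<open>v \<in> space I01\<close> W[of u v] show ?case
          by (simp add: w_def)
      qed
    qed
  qed
qed

text \<open>A degree depends on its section only up to a null set, so the two degree functions agree
  almost everywhere. The kernels then agree wherever the values and both degrees do.\<close>

lemma AE_normalized_graphon_cong: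
  assumes "graphon W" and w: "(\<lambda>(u, v). w u v) \<in> borel_measurable (I01 \<Otimes>\<^sub>M I01)"
    and eq: "AE v in I01. AE u in I01. W u v = w u v"
  shows "AE v in I01. AE u in I01. normalized_graphon W u v = normalized_graphon w u v"
proof -
  have d: "AE v in I01. graphon_degree W v = graphon_degree w v"
    using eq AE_space
  proof eventually_elim
    case (elim v)
    show ?case
      unfolding graphon_degree_def
    proof (rule integral_I01_cong_AE)
      show "(\<lambda>u. w u v) \<in> borel_measurable I01"
        using measurable_Pair1[OF w elim(2)] by simp
    qed (rule elim(1))
  qed
  from eq d show ?thesis
  proof eventually_elim
    case (elim v)
    from elim(1) d show ?case
      by eventually_elim (use elim(2) in \<open>simp add: normalized_graphon_def\<close>)
  qed
qed

section \<open>Symmetry of the kernel operator and of the Laplacian\<close>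

text \<open>Fubini's theorem is applied to the Borel version \<open>w\<close>, and the results pass
  to \<open>W\<close> because \<open>T\<close> and its Borel counterpart \<open>t\<close> agree
  almost everywhere. \<open>T f\<close> is not shown to lie in \<open>L2\<close>, so its
  integrability against \<open>g\<close> is a conclusion of its own.\<close>

lemma graphon_operator_selfadjoint:
  fixes W :: "real \<Rightarrow> real \<Rightarrow> real"
  defines "T \<equiv> \<lambda>f v. \<integral>u. normalized_graphon W u v * f u \<partial>I01"
  assumes W: "graphon W" and f: "f \<in> L2" and g: "g \<in> L2"
  shows "T f \<in> borel_measurable I01"
    and "integrable I01 (\<lambda>v. T f v * g v)"
    and "L2_inner (T f) g = L2_inner f (T g)"
proof -
  obtain w where w[measurable]: "(\<lambda>(u, v). w u v) \<in> borel_measurable (I01 \<Otimes>\<^sub>M I01)"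
    and sym: "\<And>u v. w u v = w v u" and bounds: "\<And>u v. 0 \<le> w u v" "\<And>u v. w u v \<le> 1"
    and eq: "AE v in I01. AE u in I01. W u v = w u v"
    using graphon_borel_version[OF W] by blast
  let ?k = "normalized_graphon w"
  define t where "t h v = (\<integral>u. ?k u v * h u \<partial>I01)" for h v
  have k[measurable]: "(\<lambda>(u, v). ?k u v) \<in> borel_measurable (I01 \<Otimes>\<^sub>M I01)"
    by (rule measurable_normalized_graphon[OF w])
  have t_meas: "t h \<in> borel_measurable I01" if "h \<in> L2" for h
  proof -
    have [measurable]: "h \<in> borel_measurable I01" using that by (simp add: L2_def)
    have "(\<lambda>v. \<integral>u. ?k u v * h u \<partial>I01) \<in> borel_measurable I01" by measurable
    then show ?thesis by (simp add: t_def[abs_def])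
  qed
  have Tt: "AE v in I01. T h v = t h v" if h: "h \<in> L2" for h
    using AE_normalized_graphon_cong[OF W w eq] AE_space
  proof eventually_elim
    case (elim v)
    show ?case
      unfolding T_def t_def
    proof (rule integral_I01_cong_AE)
      have "(\<lambda>u. ?k u v) \<in> borel_measurable I01"
        using measurable_Pair1[OF k elim(2)] by simp
      then show "(\<lambda>u. ?k u v * h u) \<in> borel_measurable I01"
        using h by (auto simp: L2_def)
      show "AE u in I01. normalized_graphon W u v * h u = ?k u v * h u"
        using elim(1) by eventually_elim simp
    qed
  qed
  show Tf: "T f \<in> borel_measurable I01"
    using borel_measurable_I01_cong_AE[OF t_meas Tt] f by blast
  have int: "integrable (I01 \<Otimes>\<^sub>M I01) (\<lambda>(u, v). ?k u v * (f u * g v))"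
    by (rule integrable_normalized_kernel[OF w sym bounds f g])
  have fm: "f \<in> borel_measurable I01" and gm: "g \<in> borel_measurable I01"
    using f g by (simp_all add: L2_def)
  have inner1: "(\<integral>u. ?k u v * (f u * g v) \<partial>I01) = t f v * g v" for v
    by (simp add: t_def mult.assoc[symmetric])
  \<comment> \<open>Symmetry of the kernel lets an integral over its second argument be read as
    \<open>t g\<close>.\<close>
  have inner2: "(\<integral>v. ?k u v * (f u * g v) \<partial>I01) = f u * t g u" for u
    by (simp add: t_def normalized_graphon_sym[where w = w and u = u, OF sym] mult.left_commute)
  have eqf: "AE v in I01. T f v * g v = t f v * g v"
    using Tt[OF f] by eventually_elim simp
  show "integrable I01 (\<lambda>v. T f v * g v)"
    using I01_pair.integrable_snd[OF int] Tf gm t_meas[OF f] eqf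
    unfolding inner1 by (subst integrable_cong_AE) auto
  have "L2_inner (T f) g = (\<integral>v. t f v * g v \<partial>I01)"
    unfolding L2_inner_def
    by (rule integral_I01_cong_AE) (use t_meas[OF f] gm eqf in auto)
  also have "\<dots> = (\<integral>u. f u * t g u \<partial>I01)"
    using I01_pair.Fubini_integral[OF int] by (simp only: inner1 inner2)
  also have "\<dots> = L2_inner f (T g)"
  proof -
    have "AE u in I01. f u * T g u = f u * t g u"
      using Tt[OF g] by eventually_elim simp
    then show ?thesis
      unfolding L2_inner_def
      by (intro integral_I01_cong_AE[symmetric]) (use t_meas[OF g] fm in auto)
  qed
  finally show "L2_inner (T f) g = L2_inner f (T g)" .
qed

lemma measurable_normalized_laplacian:
  assumes "graphon W" "X \<in> L2"
  shows "normalized_laplacian W X \<in> borel_measurable I01"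
proof -
  have "(\<lambda>v. X v - (\<integral>u. normalized_graphon W u v * X u \<partial>I01)) \<in> borel_measurable I01"
    using graphon_operator_selfadjoint(1)[OF assms assms(2)] assms(2)
    by (intro borel_measurable_diff) (auto simp: L2_def)
  then show ?thesis
    by (simp add: normalized_laplacian_def[abs_def])
qed

text \<open>Symmetry moves the kernel operator from \<open>X\<close> onto \<open>\<psi>\<close>,
  where the eigenvalue equation applies almost everywhere. The integrals are split using
  integrability of the products alone, without presupposing that the Laplacian of \<open>X\<close>
  lies in \<open>L2\<close>.\<close>

lemma inner_normalized_laplacian_eigenfunction:
  assumes W: "graphon W" and X: "X \<in> L2" and \<psi>: "\<psi> \<in> L2"
    and eig: "AE v in I01. normalized_laplacian W \<psi> v = e * \<psi> v"
  shows "L2_inner (normalized_laplacian W X) \<psi> = e * L2_inner X \<psi>"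
proof -
  define T where "T f v = (\<integral>u. normalized_graphon W u v * f u \<partial>I01)" for f v
  have T: "integrable I01 (\<lambda>v. T f v * g v)" "L2_inner (T f) g = L2_inner f (T g)"
    if "f \<in> L2" "g \<in> L2" for f g
    using graphon_operator_selfadjoint(2,3)[OF W that] by (simp_all add: T_def[abs_def])
  have "L2_inner (normalized_laplacian W X) \<psi> = (\<integral>v. X v * \<psi> v - T X v * \<psi> v \<partial>I01)"
    by (simp add: L2_inner_def normalized_laplacian_def T_def left_diff_distrib)
  also have "\<dots> = L2_inner X \<psi> - L2_inner (T X) \<psi>"
    unfolding L2_inner_def
    by (intro Bochner_Integration.integral_diff L2_mult_integrable T X \<psi>)
  also have "\<dots> = (\<integral>v. X v * \<psi> v - X v * T \<psi> v \<partial>I01)"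
    unfolding T(2)[OF X \<psi>] unfolding L2_inner_def
    using T(1)[OF \<psi> X]
    by (subst Bochner_Integration.integral_diff) (simp_all add: L2_mult_integrable X \<psi> mult.commute)
  also have "\<dots> = (\<integral>v. e * (X v * \<psi> v) \<partial>I01)"
  proof (rule integral_I01_cong_AE)
    show "(\<lambda>v. e * (X v * \<psi> v)) \<in> borel_measurable I01"
      using X \<psi> by (auto simp: L2_def)
    show "AE v in I01. X v * \<psi> v - X v * T \<psi> v = e * (X v * \<psi> v)"
      using eig
    proof eventually_elim
      case (elim v)
      have "X v * \<psi> v - X v * T \<psi> v = X v * normalized_laplacian W \<psi> v"
        by (simp add: normalized_laplacian_def T_def right_diff_distrib)
      then show ?case
        by (simp add: elim)
    qed
  qed
  finally show ?thesis
    by (simp add: L2_inner_def)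
qed

section \<open>Band-limited signals and uniqueness\<close>

lemma paley_wiener_diff:
  assumes "\<And>i. \<phi> i \<in> L2" "X \<in> paley_wiener ev \<phi> \<omega>" "Y \<in> paley_wiener ev \<phi> \<omega>"
  shows "(\<lambda>u. X u - Y u) \<in> paley_wiener ev \<phi> \<omega>"
proof -
  have "X \<in> L2" "Y \<in> L2"
    using assms by (simp_all add: paley_wiener_def)
  then have "L2_inner (\<lambda>u. X u - Y u) (\<phi> i) = L2_inner X (\<phi> i) - L2_inner Y (\<phi> i)" for i
    by (simp add: L2_inner_def left_diff_distrib L2_mult_integrable assms(1))
  then show ?thesis
    using assms by (auto simp: paley_wiener_def fourier_coeff_def L2_diff)
qed

text \<open>A Bernstein inequality: on a band-limited signal the Laplacian multiplies each surviving
  coefficient by at most \<open>\<omega>\<close>, and Parseval turns this termwise bound into one on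
  norms.\<close>

lemma paley_wiener_bernstein:
  assumes W: "graphon W" and es: "laplacian_eigensystem W ev \<phi>"
    and "0 \<le> \<omega>" and Z: "Z \<in> paley_wiener ev \<phi> \<omega>"
  shows "L2_norm (normalized_laplacian W Z) \<le> \<omega> * L2_norm Z"
proof (cases "integrable I01 (\<lambda>v. (normalized_laplacian W Z v)\<^sup>2)")
  case False
  text \<open>The Laplacian is not shown to map \<open>L2\<close> to \<open>L2\<close>: a non-integrable square has integral 0.\<close>
  then have "L2_norm (normalized_laplacian W Z) = 0"
    by (simp add: L2_norm_def not_integrable_integral_eq)
  with \<open>0 \<le> \<omega>\<close> show ?thesis
    by (simp add: L2_norm_def integral_nonneg_AE)
next
  case True
  have Z2: "Z \<in> L2" and band: "\<And>i. ev i > \<omega> \<Longrightarrow> L2_inner Z (\<phi> i) = 0"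
    using Z by (auto simp: paley_wiener_def fourier_coeff_def)
  have onb: "orthonormal_basis_L2 \<phi>" and ev: "\<And>i. 0 \<le> ev i"
    and eig: "\<And>i. AE v in I01. normalized_laplacian W (\<phi> i) v = ev i * \<phi> i v"
    using es by (auto simp: laplacian_eigensystem_def)
  have LZ: "normalized_laplacian W Z \<in> L2"
    using True measurable_normalized_laplacian[OF W Z2] by (simp add: L2_def)
  have coeff: "L2_inner (normalized_laplacian W Z) (\<phi> i) = ev i * L2_inner Z (\<phi> i)" for i
    using onb by (intro inner_normalized_laplacian_eigenfunction W Z2 eig) (simp add: orthonormal_basis_L2_def)
  have "(L2_norm (normalized_laplacian W Z))\<^sup>2 \<le> \<omega>\<^sup>2 * (L2_norm Z)\<^sup>2"
  proof (rule sums_le)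
    show "(\<lambda>i. (ev i * L2_inner Z (\<phi> i))\<^sup>2) sums (L2_norm (normalized_laplacian W Z))\<^sup>2"
      using parseval[OF onb LZ] by (simp add: coeff)
    show "(\<lambda>i. \<omega>\<^sup>2 * (L2_inner Z (\<phi> i))\<^sup>2) sums (\<omega>\<^sup>2 * (L2_norm Z)\<^sup>2)"
      by (intro sums_mult parseval onb Z2)
    \<comment> \<open>Above the cutoff the coefficient is 0; below it, squaring is monotone because
      the eigenvalues are nonnegative.\<close>
    show "(ev i * L2_inner Z (\<phi> i))\<^sup>2 \<le> \<omega>\<^sup>2 * (L2_inner Z (\<phi> i))\<^sup>2" for i
      using band[of i] ev[of i]
      by (cases "ev i > \<omega>") (auto simp: power_mult_distrib intro!: mult_right_mono power_mono)
  qed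
  then have "(L2_norm (normalized_laplacian W Z))\<^sup>2 \<le> (\<omega> * L2_norm Z)\<^sup>2"
    by (simp add: power_mult_distrib)
  then show ?thesis
    by (rule power2_le_imp_le) (simp add: \<open>0 \<le> \<omega>\<close> L2_norm_def integral_nonneg_AE)
qed

lemma supported_on_complement:
  assumes S: "S \<in> sets lebesgue" and Z: "Z \<in> L2"
    and 0: "(\<integral>u. (Z u)\<^sup>2 \<partial>lebesgue_on ({0..1} - S)) = 0"
  shows "supported_on Z S"
proof -
  let ?U = "{0..1} - S"
  have U: "?U \<in> sets lebesgue"
    using S by auto
  have eq: "lebesgue_on ?U = restrict_space I01 ?U"
    using U by (subst restrict_restrict_space) (auto simp: Int_absorb1)
  have UI: "?U \<inter> space I01 \<in> sets I01"
    using U by (auto simp: sets_restrict_space_iff)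
  \<comment> \<open>A Bochner integral is also 0 by convention when the integrand is not integrable,
    so integrability is secured before the zero integral is used to make \<open>Z\<close> vanish
    almost everywhere on \<open>?U\<close>.\<close>
  have "integrable (lebesgue_on ?U) (\<lambda>u. (Z u)\<^sup>2)"
    unfolding eq integrable_restrict_space[OF UI]
    using Z U by (intro integrable_mult_indicator) (auto simp: L2_def sets_restrict_space_iff)
  with 0 have "AE u in lebesgue_on ?U. Z u = 0"
    by (subst (asm) integral_nonneg_eq_0_iff_AE) auto
  then have "AE u in I01. u \<in> ?U \<longrightarrow> Z u = 0"
    unfolding eq by (subst (asm) AE_restrict_space_iff[OF UI])
  then show ?thesis
    unfolding supported_on_def using AE_space by eventually_elim auto
qed

theorem theorem3:
  fixes W :: "real \<Rightarrow> real \<Rightarrow> real"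
    and ev :: "nat \<Rightarrow> real" and \<phi> :: "nat \<Rightarrow> real \<Rightarrow> real"
    and S :: "real set" and \<Lambda> :: real
  assumes "graphon W"
    and "laplacian_eigensystem W ev \<phi>"
    and "S \<in> sets lebesgue" and "S \<subset> {0..1}"
    and "\<Lambda> > 0"
    and "\<And>X. X \<in> L2 \<Longrightarrow> supported_on X S \<Longrightarrow>
           L2_norm X \<le> \<Lambda> * L2_norm (normalized_laplacian W X)"
  shows "\<forall>\<omega>. 0 \<le> \<omega> \<and> \<omega> < 1 / \<Lambda> \<longrightarrow> uniqueness_set ({0..1} - S) (paley_wiener ev \<phi> \<omega>)"
proof (intro allI impI)
  fix \<omega> assume \<omega>: "0 \<le> \<omega> \<and> \<omega> < 1 / \<Lambda>"
  have \<phi>: "\<phi> i \<in> L2" for i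
    using assms(2) by (simp add: laplacian_eigensystem_def orthonormal_basis_L2_def)
  show "uniqueness_set ({0..1} - S) (paley_wiener ev \<phi> \<omega>)"
    unfolding uniqueness_set_def
  proof (intro conjI ballI impI)
    show "{0..1} - S \<in> sets lebesgue" "{0..1} - S \<subseteq> {0..1}"
      using assms(3) by auto
    fix X Y
    assume XY: "X \<in> paley_wiener ev \<phi> \<omega>" "Y \<in> paley_wiener ev \<phi> \<omega>"
      and 0: "(\<integral>u. \<bar>X u - Y u\<bar>\<^sup>2 \<partial>lebesgue_on ({0..1} - S)) = 0"
    let ?Z = "\<lambda>u. X u - Y u"
    have Z: "?Z \<in> paley_wiener ev \<phi> \<omega>"
      by (rule paley_wiener_diff[OF \<phi> XY])
    then have Z2: "?Z \<in> L2"
      by (simp add: paley_wiener_def)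
    have "L2_norm ?Z \<le> \<Lambda> * L2_norm (normalized_laplacian W ?Z)"
      using 0 by (intro assms(6) Z2 supported_on_complement assms(3)) simp
    also have "\<dots> \<le> \<Lambda> * (\<omega> * L2_norm ?Z)"
      using \<omega> assms(5) by (intro mult_left_mono paley_wiener_bernstein[OF assms(1,2) _ Z]) auto
    finally have "(1 - \<Lambda> * \<omega>) * L2_norm ?Z \<le> 0"
      by (simp add: algebra_simps)
    \<comment> \<open>The strict inequality between \<open>\<omega>\<close> and
      \<open>1 / \<Lambda>\<close> enters here: a positive factor leaves no room for a positive
      norm.\<close>
    moreover have "1 - \<Lambda> * \<omega> > 0"
      using \<omega> assms(5) by (simp add: field_simps)
    ultimately have "L2_norm ?Z \<le> 0"
      by (simp add: mult_le_0_iff)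
    moreover have "0 \<le> L2_norm ?Z"
      by (simp add: L2_norm_def integral_nonneg_AE)
    ultimately show "(L2_norm ?Z)\<^sup>2 = 0"
      by simp
  qed
qed

end
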